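(* The following two inequalities hold: $$\frac{1}{(q,q^4,q^5,q^9,q^{11};q^{12})_{\infty}} - \frac{1}{(q,q^5,q^7,q^8,q^9;q^{12})_{\infty}} \succeq 0,$$ $$\frac{1}{(q,q^3,q^7,q^8,q^{11};q^{12})_{\infty}} - \frac{1}{(q^3,q^4,q^5,q^7,q^{11};q^{12})_{\infty}} \succeq 0.$$
   Context: Notation: $(x;q)_\infty := \prod_{j=0}^{\infty}(1-xq^j)$ and $(x_1,\dots,x_r;q)_\infty := (x_1;q)_\infty\cdots(x_r;q)_\infty$; thus $(q^{s_1},\dots,q^{s_r};q^{12})_\infty=\prod_{j\ge 0}\prod_{i=1}^r(1-q^{12j+s_i})$. Quotients are expanded as formal power series in $q$. For a power series $f(q)=\sum_{n\ge 0}a_nq^n$, $f(q)\succeq 0$ means $a_n\geq 0$ for all $n$. *)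

theory Defs
  imports "HOL-Analysis.Analysis" "HOL-Computational_Algebra.Formal_Power_Series"
begin

text \<open>
  Everything takes place in the ring of formal power series with real coefficients; the
  infinite products converge in its (coefficientwise) topology, and the quotients are
  quotients of formal power series.
\<close>

definition qpoch_inf :: "real fps \<Rightarrow> real fps \<Rightarrow> real fps" where
  "qpoch_inf x q = (\<Prod>j. 1 - x * q ^ j)"

definition qpochs_inf :: "real fps list \<Rightarrow> real fps \<Rightarrow> real fps" where
  "qpochs_inf xs q = (\<Prod>x\<leftarrow>xs. qpoch_inf x q)"

definition fps_coeffs_nonneg :: "real fps \<Rightarrow> bool" where
  "fps_coeffs_nonneg f \<longleftrightarrow> (\<forall>n. fps_nth f n \<ge> 0)"

text \<open>
  For \<open>x\<close> and \<open>q\<close> with zero constant term, the infinite product genuinely converges and its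
  constant term is 1, so that neither \<^const>\<open>prodinf\<close> nor the division by such a product is
  a default value.
\<close>

lemma qpoch_inf_has_prod:
  assumes "fps_nth x 0 = 0" and "fps_nth q 0 = 0"
  shows "(\<lambda>j. 1 - x * q ^ j) has_prod qpoch_inf x q"
    and "fps_nth (qpoch_inf x q) 0 = 1"
proof -
  let ?f = "\<lambda>j. 1 - x * q ^ j"
  have f0: "fps_nth (?f j) 0 = 1" for j
    using assms by simp
  have nz: "?f j \<noteq> 0" for j
    using f0[of j] by (metis fps_zero_nth zero_neq_one)
  have "\<exists>m. \<forall>k>m. fps_nth (\<Prod>j\<le>k. ?f j) n = fps_nth (\<Prod>j\<le>m. ?f j) n" for n
  proof -
    have step: "fps_nth (\<Prod>j\<le>Suc k. ?f j) n = fps_nth (\<Prod>j\<le>k. ?f j) n" if "k \<ge> n" for k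
    proof -
      let ?P = "\<Prod>j\<le>k. ?f j"
      have *: "fps_nth (q ^ Suc k * (x * ?P)) n = 0"
        unfolding fps_mult_nth[of "q ^ Suc k"]
      proof (intro sum.neutral ballI)
        fix i assume "i \<in> {0..n}"
        hence "fps_nth (q ^ Suc k) i = 0"
          using that assms(2) by (intro startsby_zero_power_prefix[rule_format]) auto
        thus "fps_nth (q ^ Suc k) i * fps_nth (x * ?P) (n - i) = 0"
          by simp
      qed
      have "(\<Prod>j\<le>Suc k. ?f j) = ?P - q ^ Suc k * (x * ?P)"
        by (simp add: algebra_simps)
      thus ?thesis using * by simp
    qed
    have "fps_nth (\<Prod>j\<le>k. ?f j) n = fps_nth (\<Prod>j\<le>n. ?f j) n" if "k \<ge> n" for k
      using that by (induction k rule: dec_induct) (simp_all only: step)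
    thus ?thesis by (metis less_imp_le)
  qed
  then obtain g where g: "\<And>n k. k > g n \<Longrightarrow>
      fps_nth (\<Prod>j\<le>k. ?f j) n = fps_nth (\<Prod>j\<le>g n. ?f j) n"
    by metis
  define P where "P = Abs_fps (\<lambda>n. fps_nth (\<Prod>j\<le>g n. ?f j) n)"
  have lim: "(\<lambda>k. \<Prod>j\<le>k. ?f j) \<longlonglongrightarrow> P"
  proof (rule tendsto_fpsI)
    fix n
    show "\<forall>\<^sub>F k in sequentially. fps_nth (\<Prod>j\<le>k. ?f j) n = fps_nth P n"
      using eventually_gt_at_top[of "g n"]
      by eventually_elim (simp only: g P_def fps_nth_Abs_fps)
  qed
  have "fps_nth (\<Prod>j\<le>k. ?f j) 0 = 1" for k
    by (induction k) (simp_all add: f0 assms)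
  hence P0: "fps_nth P 0 = 1"
    by (simp add: P_def)
  hence "P \<noteq> 0" by auto
  with lim have hp: "?f has_prod P"
    by (simp add: has_prod_def raw_has_prod_def)
  hence eq: "qpoch_inf x q = P"
    unfolding qpoch_inf_def using has_prod_unique by metis
  show "?f has_prod qpoch_inf x q" using hp eq by simp
  show "fps_nth (qpoch_inf x q) 0 = 1" using P0 eq by simp
qed

end

theory Submission
  imports Defs
begin

text \<open>
  For \<open>a + d = b + c\<close> with \<open>b = a + u\<close> and \<open>c = a + v\<close>,
  \[ \frac{1}{(1-q^a)(1-q^d)} - \frac{1}{(1-q^b)(1-q^c)}
     = \frac{q^a (1-q^u)(1-q^v)}{(1-q^a)(1-q^b)(1-q^c)(1-q^d)}. \]
  After removing the common factors, both inequalities compare \<open>1 / (q^s, q^(s+u+v); q^12)\<close> with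
  \<open>1 / (q^(s+u), q^(s+v); q^12)\<close> where \<open>u = 3\<close> and \<open>v = 4\<close> (\<open>s = 4\<close> in the first, \<open>s = 1\<close> in the
  second).  Telescoping over the index \<open>j\<close> of the products, with \<open>a = 12 j + s\<close>, every summand
  contains the factor \<open>1 / (1-q^s)\<close>, which absorbs \<open>1-q^v\<close> because \<open>s\<close> divides \<open>v\<close>; the factor
  \<open>1-q^u\<close> is absorbed by a common factor \<open>1 / (1-q^w)\<close> with \<open>w\<close> dividing \<open>u\<close> (\<open>w = 1\<close> in the first,
  \<open>w = 3\<close> in the second).
\<close>

section \<open>Nonnegative coefficients: closure properties and limits\<close>

lemma fps_coeffs_nonneg_1: "fps_coeffs_nonneg 1"
  by (simp add: fps_coeffs_nonneg_def)

lemma fps_coeffs_nonneg_fps_X_power: "fps_coeffs_nonneg (fps_X ^ n)"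
  by (simp add: fps_coeffs_nonneg_def fps_X_power_nth)

lemma fps_coeffs_nonneg_add:
  "fps_coeffs_nonneg f \<Longrightarrow> fps_coeffs_nonneg g \<Longrightarrow> fps_coeffs_nonneg (f + g)"
  by (simp add: fps_coeffs_nonneg_def)

lemma fps_coeffs_nonneg_mult:
  "fps_coeffs_nonneg f \<Longrightarrow> fps_coeffs_nonneg g \<Longrightarrow> fps_coeffs_nonneg (f * g)"
  by (simp add: fps_coeffs_nonneg_def fps_mult_nth sum_nonneg)

lemma fps_coeffs_nonneg_sum:
  "(\<And>x. x \<in> A \<Longrightarrow> fps_coeffs_nonneg (f x)) \<Longrightarrow> fps_coeffs_nonneg (sum f A)"
  by (simp add: fps_coeffs_nonneg_def fps_sum_nth sum_nonneg)

lemma fps_coeffs_nonneg_prod: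
  "(\<And>x. x \<in> A \<Longrightarrow> fps_coeffs_nonneg (f x)) \<Longrightarrow> fps_coeffs_nonneg (prod f A)"
  by (induction A rule: infinite_finite_induct)
     (auto intro: fps_coeffs_nonneg_1 fps_coeffs_nonneg_mult)

text \<open>Convergence of power series means that each coefficient is eventually constant, so every
  coefficient of the limit already occurs in some \<open>F N\<close>.\<close>

lemma fps_coeffs_nonneg_lim:
  assumes "F \<longlonglongrightarrow> f" and "\<And>N. fps_coeffs_nonneg (F N)"
  shows "fps_coeffs_nonneg f"
  unfolding fps_coeffs_nonneg_def
proof
  fix n
  have "\<forall>\<^sub>F N in sequentially. fps_nth (F N) n = fps_nth f n"
    using assms(1) by (simp add: tendsto_fps_iff)
  then obtain N where "fps_nth (F N) n = fps_nth f n"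
    using eventually_happens'[OF sequentially_bot] by blast
  thus "fps_nth f n \<ge> 0"
    using assms(2) by (metis fps_coeffs_nonneg_def)
qed

lemma tendsto_diff_fps:
  fixes a b :: "'a :: ab_group_add fps"
  assumes "(f \<longlongrightarrow> a) F" and "(g \<longlongrightarrow> b) F"
  shows "((\<lambda>x. f x - g x) \<longlongrightarrow> a - b) F"
proof (rule tendsto_fpsI)
  fix n
  show "\<forall>\<^sub>F x in F. fps_nth (f x - g x) n = fps_nth (a - b) n"
    using assms[unfolded tendsto_fps_iff, rule_format, of n]
    by eventually_elim simp
qed

lemma tendsto_mult_fps:
  fixes a b :: "'a :: ring fps"
  assumes "(f \<longlongrightarrow> a) F" and "(g \<longlongrightarrow> b) F"
  shows "((\<lambda>x. f x * g x) \<longlongrightarrow> a * b) F"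
proof (rule tendsto_fpsI)
  fix n
  have "\<forall>\<^sub>F x in F. \<forall>i\<in>{0..n}. fps_nth (f x) i = fps_nth a i \<and> fps_nth (g x) i = fps_nth b i"
    using assms by (intro eventually_ball_finite) (auto simp: tendsto_fps_iff eventually_conj_iff)
  thus "\<forall>\<^sub>F x in F. fps_nth (f x * g x) n = fps_nth (a * b) n"
    by eventually_elim (simp add: fps_mult_nth)
qed

section \<open>Geometric series\<close>

definition geom :: "nat \<Rightarrow> real fps" where
  "geom n = inverse (1 - fps_X ^ n)"

lemma geom_mult: "n > 0 \<Longrightarrow> geom n * (1 - fps_X ^ n) = 1"
  unfolding geom_def by (rule inverse_mult_eq_1) simp

text \<open>The quotient of \<open>1 - fps_X ^ k\<close> by \<open>1 - fps_X ^ n\<close> is a finite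
  geometric sum. This is how factors with a negative coefficient get absorbed.\<close>

lemma geom_mult_dvd_nonneg:
  assumes "n > 0" "n dvd k"
  shows "fps_coeffs_nonneg (geom n * (1 - fps_X ^ k))"
proof -
  obtain l where k: "k = n * l"
    using assms(2) by blast
  have "geom n * (1 - fps_X ^ k) = geom n * (1 - fps_X ^ n) * (\<Sum>i<l. fps_X ^ (n * i))"
    by (simp add: k power_mult one_diff_power_eq mult.assoc)
  thus ?thesis
    using assms(1)
    by (auto simp: geom_mult intro: fps_coeffs_nonneg_sum fps_coeffs_nonneg_fps_X_power)
qed

lemma geom_nonneg:
  assumes "n > 0"
  shows "fps_coeffs_nonneg (geom n)"
proof -
  let ?F = "Abs_fps (\<lambda>k. if n dvd k then 1 else 0) :: real fps"
  have "?F * (1 - fps_X ^ n) = 1"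
  proof (rule fps_ext)
    fix k
    have "fps_nth (?F * (1 - fps_X ^ n)) k
          = (if n dvd k then 1 else 0) - (if k < n then 0 else if n dvd k - n then 1 else 0)"
      by (simp add: right_diff_distrib fps_X_power_mult_right_nth)
    thus "fps_nth (?F * (1 - fps_X ^ n)) k = fps_nth 1 k"
      using assms by (cases "k = 0") (auto simp: dvd_minus_self dest: dvd_imp_le)
  qed
  hence "(1 - fps_X ^ n) * ?F = 1"
    by (simp only: mult.commute)
  hence "geom n = ?F"
    unfolding geom_def by (rule fps_inverse_unique)
  thus ?thesis
    by (simp add: fps_coeffs_nonneg_def)
qed

lemma geom_pair_diff:
  assumes "a > 0"
  shows "geom a * geom (a + u + v) - geom (a + u) * geom (a + v)
         = fps_X ^ a * (1 - fps_X ^ u) * (1 - fps_X ^ v)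
           * (geom a * geom (a + u) * geom (a + v) * geom (a + u + v))"
proof -
  define A B C D :: "real fps"
    where "A = 1 - fps_X ^ a" and "B = 1 - fps_X ^ (a + u)"
      and "C = 1 - fps_X ^ (a + v)" and "D = 1 - fps_X ^ (a + u + v)"
  have g: "geom a * A = 1" "geom (a + u) * B = 1" "geom (a + v) * C = 1"
          "geom (a + u + v) * D = 1"
    using assms by (simp_all add: A_def B_def C_def D_def geom_mult)
  have "geom a * geom (a + u + v) - geom (a + u) * geom (a + v)
        = geom a * geom (a + u + v) * (geom (a + u) * B) * (geom (a + v) * C)
          - geom (a + u) * geom (a + v) * (geom a * A) * (geom (a + u + v) * D)"
    by (simp add: g)
  also have "\<dots> = (B * C - A * D) * (geom a * geom (a + u) * geom (a + v) * geom (a + u + v))"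
    by (simp add: algebra_simps)
  \<comment> \<open>The terms of degree \<open>2 * a + u + v\<close> cancel, and the rest
    factors.\<close>
  also have "B * C - A * D = fps_X ^ a * (1 - fps_X ^ u) * (1 - fps_X ^ v)"
    by (simp add: A_def B_def C_def D_def power_add algebra_simps)
  finally show ?thesis .
qed

section \<open>Truncated products\<close>

definition geom_prod :: "nat \<Rightarrow> nat \<Rightarrow> nat \<Rightarrow> real fps" where
  "geom_prod m s N = (\<Prod>j\<le>N. geom (m * j + s))"

lemma geom_prod_0: "geom_prod m s 0 = geom s"
  by (simp add: geom_prod_def)

lemma geom_prod_Suc: "geom_prod m s (Suc N) = geom_prod m s N * geom (m * Suc N + s)"
  by (simp add: geom_prod_def)

lemma geom_prod_nonneg: "s > 0 \<Longrightarrow> fps_coeffs_nonneg (geom_prod m s N)"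
  unfolding geom_prod_def by (intro fps_coeffs_nonneg_prod geom_nonneg) simp

text \<open>The range \<open>j \<le> N\<close> always contains 0, so the absorbing factor
  \<open>geom s\<close> is available for every \<open>N\<close>.\<close>

lemma geom_prod_split:
  assumes "s > 0"
  obtains h where "geom_prod m s N = geom s * h" and "fps_coeffs_nonneg h"
proof
  show "geom_prod m s N = geom s * (\<Prod>j\<in>{1..N}. geom (m * j + s))"
    unfolding geom_prod_def
    by (simp add: atMost_atLeast0 prod.atLeast_Suc_atMost)
  show "fps_coeffs_nonneg (\<Prod>j\<in>{1..N}. geom (m * j + s))"
    using assms by (intro fps_coeffs_nonneg_prod geom_nonneg) simp
qed

text \<open>Induction on \<open>N\<close> carries out the telescoping. One \<open>geom w\<close>
  suffices for all summands, since the gap \<open>u\<close> is the same at every index.\<close>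

lemma geom_prod_diff_nonneg:
  assumes "w > 0" "w dvd u" "s > 0" "s dvd v"
  shows "fps_coeffs_nonneg
           (geom w * (geom_prod m s N * geom_prod m (s + u + v) N
                      - geom_prod m (s + u) N * geom_prod m (s + v) N))"
proof -
  note nonneg = fps_coeffs_nonneg_mult fps_coeffs_nonneg_fps_X_power geom_nonneg geom_prod_nonneg
    geom_mult_dvd_nonneg[OF assms(1,2)] geom_mult_dvd_nonneg[OF assms(3,4)]
  show ?thesis
  proof (induction N)
    case 0
    have "geom w * (geom s * geom (s + u + v) - geom (s + u) * geom (s + v))
          = (geom w * (1 - fps_X ^ u)) * (geom s * (1 - fps_X ^ v))
            * (fps_X ^ s * geom (s + u) * geom (s + v) * geom (s + u + v))"
      by (simp only: geom_pair_diff[OF assms(3)] mult_ac)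
    also have "fps_coeffs_nonneg \<dots>"
      using assms by (intro nonneg) simp_all
    finally show ?case by (simp add: geom_prod_0)
  next
    case (Suc N)
    define a where "a = m * Suc N + s"
    have a: "a > 0" using assms by (simp add: a_def)
    have shift: "m * Suc N + (s + u) = a + u" "m * Suc N + (s + v) = a + v"
                "m * Suc N + (s + u + v) = a + u + v"
      by (simp_all add: a_def)
    obtain h where h: "geom_prod m s N = geom s * h" "fps_coeffs_nonneg h"
      using geom_prod_split[OF assms(3)] .
    define P Q where "P = geom_prod m (s + u + v) N"
      and "Q = geom_prod m (s + u) N * geom_prod m (s + v) N"
    \<comment> \<open>This is \<open>x * p - y * r = (x - y) * r + x * (p - r)\<close>, with
      \<open>p\<close> and \<open>r\<close> the two new pairs of factors; the induction hypothesis
      covers \<open>x - y\<close>.\<close>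
    have "geom w * (geom_prod m s (Suc N) * geom_prod m (s + u + v) (Suc N)
            - geom_prod m (s + u) (Suc N) * geom_prod m (s + v) (Suc N))
          = geom w * (geom_prod m s N * P - Q) * (geom (a + u) * geom (a + v))
            + geom w * geom_prod m s N * P
              * (geom a * geom (a + u + v) - geom (a + u) * geom (a + v))"
      unfolding geom_prod_Suc shift a_def[symmetric] P_def Q_def by (simp add: algebra_simps)
    \<comment> \<open>As \<open>a\<close> need not divide \<open>v\<close>, it is the
      \<open>geom s\<close> inside \<open>geom_prod m s N\<close>, not \<open>geom a\<close>, that
      absorbs \<open>1 - fps_X ^ v\<close>.\<close>
    also have "geom w * geom_prod m s N * P
              * (geom a * geom (a + u + v) - geom (a + u) * geom (a + v))
          = (geom w * (1 - fps_X ^ u)) * (geom s * (1 - fps_X ^ v)) * (h * P)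
            * (fps_X ^ a * (geom a * geom (a + u) * geom (a + v) * geom (a + u + v)))"
      by (simp only: h(1) geom_pair_diff[OF a] mult_ac)
    also have "fps_coeffs_nonneg (geom w * (geom_prod m s N * P - Q) * (geom (a + u) * geom (a + v))
          + \<dots>)"
      using assms a h(2) Suc.IH unfolding P_def Q_def
      by (intro fps_coeffs_nonneg_add fps_coeffs_nonneg_mult[OF Suc.IH] nonneg) simp_all
    finally show ?case .
  qed
qed

section \<open>Passage to infinite products\<close>

definition inv_qpoch :: "nat \<Rightarrow> nat \<Rightarrow> real fps" where
  "inv_qpoch m s = inverse (qpoch_inf (fps_X ^ s) (fps_X ^ m))"

lemma geom_prod_tendsto:
  assumes "m > 0" "s > 0"
  shows "geom_prod m s \<longlonglongrightarrow> inv_qpoch m s"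
proof -
  have z: "fps_nth (fps_X ^ s :: real fps) 0 = 0" "fps_nth (fps_X ^ m :: real fps) 0 = 0"
    using assms by simp_all
  \<comment> \<open>Inversion is continuous where the constant term is nonzero; here it is
    1.\<close>
  have "(\<lambda>N. inverse (\<Prod>j\<le>N. 1 - fps_X ^ s * (fps_X ^ m) ^ j)) \<longlonglongrightarrow> inv_qpoch m s"
    unfolding inv_qpoch_def
    by (intro tendsto_inverse_fps has_prod_imp_tendsto qpoch_inf_has_prod(1)[OF z])
       (simp add: qpoch_inf_has_prod(2)[OF z])
  also have "(\<lambda>N. inverse (\<Prod>j\<le>N. 1 - fps_X ^ s * (fps_X ^ m) ^ j)) = geom_prod m s"
    by (simp add: fun_eq_iff geom_prod_def geom_def inverse_prod_fps power_add add.commute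
             flip: power_mult)
  finally show ?thesis .
qed

lemma inv_qpoch_nonneg: "m > 0 \<Longrightarrow> s > 0 \<Longrightarrow> fps_coeffs_nonneg (inv_qpoch m s)"
  by (rule fps_coeffs_nonneg_lim[OF geom_prod_tendsto]) (simp_all add: geom_prod_nonneg)

lemma inv_qpoch_diff_nonneg:
  assumes "m > 0" "w > 0" "w dvd u" "s > 0" "s dvd v"
  shows "fps_coeffs_nonneg
           (inv_qpoch m w * (inv_qpoch m s * inv_qpoch m (s + u + v)
                             - inv_qpoch m (s + u) * inv_qpoch m (s + v)))"
proof (rule fps_coeffs_nonneg_lim)
  let ?d = "\<lambda>N. geom_prod m s N * geom_prod m (s + u + v) N
              - geom_prod m (s + u) N * geom_prod m (s + v) N"
  show "(\<lambda>N. geom_prod m w N * ?d N) \<longlonglongrightarrow>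
          inv_qpoch m w * (inv_qpoch m s * inv_qpoch m (s + u + v)
                           - inv_qpoch m (s + u) * inv_qpoch m (s + v))"
    using assms by (intro tendsto_mult_fps tendsto_diff_fps geom_prod_tendsto) simp_all
  fix N
  obtain h where h: "geom_prod m w N = geom w * h" "fps_coeffs_nonneg h"
    using geom_prod_split[OF assms(2)] .
  \<comment> \<open>The multiplier has to converge to \<open>inv_qpoch m w\<close>; its factor
    \<open>geom w\<close> does the absorbing and \<open>h\<close> preserves nonnegativity.\<close>
  have "geom_prod m w N * ?d N = geom w * ?d N * h"
    by (simp add: h(1) mult_ac)
  thus "fps_coeffs_nonneg (geom_prod m w N * ?d N)"
    using fps_coeffs_nonneg_mult[OF geom_prod_diff_nonneg[OF assms(2-5)] h(2)] by (simp only:)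
qed

lemma inverse_qpochs_inf:
  assumes "m > 0" "\<forall>s\<in>set ss. s > 0"
  shows "1 / qpochs_inf (map (\<lambda>s. fps_X ^ s) ss) (fps_X ^ m) = (\<Prod>s\<leftarrow>ss. inv_qpoch m s)"
proof -
  let ?f = "qpochs_inf (map (\<lambda>s. fps_X ^ s) ss) (fps_X ^ m)"
  \<comment> \<open>The constant term 1 makes \<open>?f\<close> a unit, which turns division into
    multiplication by \<open>inverse ?f\<close>.\<close>
  have "fps_nth ?f 0 = 1 \<and> inverse ?f = (\<Prod>s\<leftarrow>ss. inv_qpoch m s)"
    using assms
    by (induction ss)
       (simp_all add: qpochs_inf_def qpoch_inf_has_prod(2) fps_inverse_mult inv_qpoch_def)
  thus ?thesis
    by (simp add: fps_divide_unit)
qed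

theorem proposition3p1:
  fixes q :: "real fps"
  assumes "q = fps_X"
  shows "fps_coeffs_nonneg
           (1 / qpochs_inf [q, q ^ 4, q ^ 5, q ^ 9, q ^ 11] (q ^ 12)
            - 1 / qpochs_inf [q, q ^ 5, q ^ 7, q ^ 8, q ^ 9] (q ^ 12))
       \<and> fps_coeffs_nonneg
           (1 / qpochs_inf [q, q ^ 3, q ^ 7, q ^ 8, q ^ 11] (q ^ 12)
            - 1 / qpochs_inf [q ^ 3, q ^ 4, q ^ 5, q ^ 7, q ^ 11] (q ^ 12))"
proof -
  let ?r = "inv_qpoch 12"
  \<comment> \<open>Common exponents are 1, 5, 9, of which 1 serves as \<open>w\<close>.\<close>
  have "fps_coeffs_nonneg (?r 1 * (?r 4 * ?r 11 - ?r 7 * ?r 8) * (?r 5 * ?r 9))"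
    using inv_qpoch_diff_nonneg[of 12 1 3 4 4]
    by (intro fps_coeffs_nonneg_mult[OF _ fps_coeffs_nonneg_mult] inv_qpoch_nonneg) simp_all
  \<comment> \<open>Common exponents are 3, 7, 11, of which 3 serves as \<open>w\<close>.\<close>
  moreover have "fps_coeffs_nonneg (?r 3 * (?r 1 * ?r 8 - ?r 4 * ?r 5) * (?r 7 * ?r 11))"
    using inv_qpoch_diff_nonneg[of 12 3 3 1 4]
    by (intro fps_coeffs_nonneg_mult[OF _ fps_coeffs_nonneg_mult] inv_qpoch_nonneg) simp_all
  ultimately show ?thesis
    using inverse_qpochs_inf[of 12 "[1, 4, 5, 9, 11]"] inverse_qpochs_inf[of 12 "[1, 5, 7, 8, 9]"]
      inverse_qpochs_inf[of 12 "[1, 3, 7, 8, 11]"] inverse_qpochs_inf[of 12 "[3, 4, 5, 7, 11]"]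
    by (simp add: assms algebra_simps)
qed

end
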